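(* For every infinite-dimensional Banach space $X$, every $1<q\leq2$ and every $\alpha\in(0,1]$, $$2^{-\frac{1}{q^*}}\kappa(X)^{\alpha}\leq\lambda_{\alpha}(X,L_q),$$ where $\frac1q+\frac1{q^*}=1$.
   Context: Banach spaces are real; $L_q=L_q[0,1]$ with Lebesgue measure. $B(X)$ denotes the unit ball of $X$. Kottman constant: for an infinite-dimensional Banach space $X$, $\kappa(X):=\sup_{(x_n)\subset B(X)}\operatorname{sep}(x_n)$, the supremum being over all sequences $(x_n)_{n\in\mathbb N}$ in $B(X)$, where $\operatorname{sep}(x_n)=\inf_{n\neq m}\|x_n-x_m\|$. Hölder maps: for metric spaces $(X,d)$, $(Y,\rho)$ and $\alpha\in(0,1]$, a map $f:X\to Y$ is $\alpha$-Hölder if $\operatorname{Lip}_{\alpha}(f)=\sup\{\rho(f(x),f(y))/d(x,y)^{\alpha}: x\neq y\}<\infty$. Extension constant: $\lambda_{\alpha}(X,Y)$ is the infimum of all $\lambda>0$ such that for every subset $M$ of $X$, every $\alpha$-Hölder map $f:M\to Y$ admits an extension $F:X\to Y$ with $\operatorname{Lip}_{\alpha}(F)\leq\lambda\operatorname{Lip}_{\alpha}(f)$ (with value $\infty$ if no such $\lambda$ exists). *)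

theory Defs
  imports "HOL-Analysis.Analysis"
begin

section \<open>The Kottman constant\<close>

definition infinite_dimensional :: "'a::real_vector itself \<Rightarrow> bool" where
  "infinite_dimensional _ \<longleftrightarrow> (\<nexists>B :: 'a set. finite B \<and> span B = UNIV)"

definition sep :: "(nat \<Rightarrow> 'a::real_normed_vector) \<Rightarrow> real" where
  "sep x = Inf {norm (x n - x m) | n m. n \<noteq> m}"

definition kottman :: "'a::real_normed_vector itself \<Rightarrow> real" where
  "kottman _ = Sup {sep x | x :: nat \<Rightarrow> 'a. range x \<subseteq> cball 0 1}"

text \<open>The infimum and the supremum above are taken in the reals; they are over nonempty bounded
  sets, hence genuine.\<close>

lemma sep_set_nonempty: "{norm (x n - x m) | n m :: nat. n \<noteq> m} \<noteq> {}"
proof -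
  have "norm (x 0 - x 1) \<in> {norm (x n - x m) | n m :: nat. n \<noteq> m}"
    by (intro CollectI exI[of _ 0] exI[of _ 1]) auto
  then show ?thesis by blast
qed

lemma sep_le: "n \<noteq> m \<Longrightarrow> sep x \<le> norm (x n - x m)"
  unfolding sep_def by (intro cInf_lower bdd_belowI[of _ 0]) auto

lemma sep_greatest: "(\<And>n m. n \<noteq> m \<Longrightarrow> c \<le> norm (x n - x m)) \<Longrightarrow> c \<le> sep x"
  unfolding sep_def using sep_set_nonempty[of x] by (intro cInf_greatest) auto

lemma sep_le_2: "range x \<subseteq> cball 0 1 \<Longrightarrow> sep x \<le> 2"
proof -
  assume "range x \<subseteq> cball 0 1"
  then have "norm (x n) \<le> 1" for n by (auto simp: image_subset_iff)
  then have "norm (x 0) \<le> 1" "norm (x 1) \<le> 1" by blast+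
  moreover have "sep x \<le> norm (x 0 - x 1)" by (intro sep_le) auto
  moreover have "norm (x 0 - x 1) \<le> norm (x 0) + norm (x 1)" by (rule norm_triangle_ineq4)
  ultimately show ?thesis by linarith
qed

lemma bdd_above_kottman:
  "bdd_above {sep x | x :: nat \<Rightarrow> 'a::real_normed_vector. range x \<subseteq> cball 0 1}"
  by (intro bdd_aboveI[of _ 2]) (auto intro: sep_le_2)

lemma kottman_set_nonempty:
  "{sep x | x :: nat \<Rightarrow> 'a::real_normed_vector. range x \<subseteq> cball 0 1} \<noteq> {}"
proof -
  have "sep (\<lambda>_. 0 :: 'a) \<in> {sep x | x :: nat \<Rightarrow> 'a. range x \<subseteq> cball 0 1}"
    by (intro CollectI exI[of _ "\<lambda>_. 0 :: 'a"]) auto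
  then show ?thesis by blast
qed

section \<open>Hoelder maps and extension constants\<close>

text \<open>Values lie in the extended nonnegative reals, so the supremum is \<open>0\<close> on spaces with
  at most one point, and the infimum is \<open>\<infinity>\<close> when there is no admissible
  constant.\<close>

definition Lip :: "real \<Rightarrow> 'a metric \<Rightarrow> 'b metric \<Rightarrow> ('a \<Rightarrow> 'b) \<Rightarrow> ennreal" where
  "Lip \<alpha> X Y f = Sup {ennreal (mdist Y (f x) (f y) / mdist X x y powr \<alpha>) | x y.
      x \<in> mspace X \<and> y \<in> mspace X \<and> x \<noteq> y}"

definition holder_map :: "real \<Rightarrow> 'a metric \<Rightarrow> 'b metric \<Rightarrow> ('a \<Rightarrow> 'b) \<Rightarrow> bool" where
  "holder_map \<alpha> X Y f \<longleftrightarrow> f \<in> mspace X \<rightarrow> mspace Y \<and> Lip \<alpha> X Y f < \<infinity>"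

definition extension_const :: "real \<Rightarrow> 'a metric \<Rightarrow> 'b metric \<Rightarrow> ennreal" where
  "extension_const \<alpha> X Y = Inf {ennreal c | c :: real. 0 < c \<and>
     (\<forall>M f. M \<subseteq> mspace X \<and> holder_map \<alpha> (submetric X M) Y f \<longrightarrow>
        (\<exists>F \<in> mspace X \<rightarrow> mspace Y. (\<forall>x\<in>M. F x = f x) \<and>
           Lip \<alpha> X Y F \<le> ennreal c * Lip \<alpha> (submetric X M) Y f))}"

section \<open>The spaces \<open>L\<^sub>q[0,1]\<close>\<close>

abbreviation unit_leb :: "real measure" where
  "unit_leb \<equiv> lebesgue_on {0..1}"

definition lq_fun :: "real \<Rightarrow> (real \<Rightarrow> real) set" where
  "lq_fun q = {f \<in> borel_measurable unit_leb. integrable unit_leb (\<lambda>t. \<bar>f t\<bar> powr q)}"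

definition lq_norm :: "real \<Rightarrow> (real \<Rightarrow> real) \<Rightarrow> real" where
  "lq_norm q f = (\<integral>t. \<bar>f t\<bar> powr q \<partial>unit_leb) powr (1 / q)"

definition lq_rel :: "real \<Rightarrow> ((real \<Rightarrow> real) \<times> (real \<Rightarrow> real)) set" where
  "lq_rel q = {(f, g). f \<in> lq_fun q \<and> g \<in> lq_fun q \<and> (AE t in unit_leb. f t = g t)}"

definition Lq_space :: "real \<Rightarrow> (real \<Rightarrow> real) set set" where
  "Lq_space q = lq_fun q // lq_rel q"

definition Lq_dist :: "real \<Rightarrow> (real \<Rightarrow> real) set \<Rightarrow> (real \<Rightarrow> real) set \<Rightarrow> real" where
  "Lq_dist q A B = lq_norm q (\<lambda>t. (SOME f. f \<in> A) t - (SOME g. g \<in> B) t)"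

definition Lq :: "real \<Rightarrow> (real \<Rightarrow> real) set metric" where
  "Lq q = metric (Lq_space q, Lq_dist q)"

text \<open>The remaining lemmas justify the use of \<open>metric\<close>, which is unspecified on
  pairs that are not metric spaces, and show that the distance does not depend on the chosen
  representatives.\<close>

lemma powr_convex_comb:
  fixes x y u q :: real
  assumes "1 \<le> q" "0 \<le> x" "0 \<le> y" "0 \<le> u" "u \<le> 1"
  shows "(u * x + (1 - u) * y) powr q \<le> u * x powr q + (1 - u) * y powr q"
proof -
  have scale: "(v * z) powr q \<le> v * z powr q" if "0 \<le> v" "v \<le> 1" "0 \<le> z" for v z :: real
  proof -
    have "v powr q \<le> v"
      using that assms(1) powr_mono'[of 1 q v] by (cases "v = 0") auto
    then show ?thesis using that by (simp add: powr_mult mult_right_mono)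
  qed
  consider "x = 0" | "y = 0" | "0 < x" "0 < y" using assms by linarith
  then show ?thesis
  proof cases
    case 1
    then show ?thesis using scale[of "1 - u" y] assms by simp
  next
    case 2
    then show ?thesis using scale[of u x] assms by simp
  next
    case 3
    then show ?thesis
      using convex_onD[OF powr_convex[OF assms(1)], of "1 - u" x y] assms by simp
  qed
qed

lemma abs_powr_add_le:
  fixes x y a b q :: real
  assumes "1 \<le> q" "0 < a" "0 < b"
  shows "\<bar>x + y\<bar> powr q
     \<le> (a + b) powr q * (a / (a + b) * (\<bar>x\<bar> powr q / a powr q) + b / (a + b) * (\<bar>y\<bar> powr q / b powr q))"
proof -
  define l where "l = a / (a + b)"
  have l: "0 \<le> l" "l \<le> 1" "1 - l = b / (a + b)"
    using assms by (auto simp: l_def field_simps)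
  have e: "(a + b) * (l * (\<bar>x\<bar> / a) + (1 - l) * (\<bar>y\<bar> / b)) = \<bar>x\<bar> + \<bar>y\<bar>"
  proof -
    have "(a + b) * l = a" "(a + b) * (1 - l) = b"
      unfolding l(3) using assms by (auto simp: l_def)
    then show ?thesis
      using assms by (simp add: distrib_left mult.assoc[symmetric])
  qed
  have "\<bar>x + y\<bar> powr q \<le> (\<bar>x\<bar> + \<bar>y\<bar>) powr q"
    using assms by (intro powr_mono2) auto
  also have "\<dots> = (a + b) powr q * (l * (\<bar>x\<bar> / a) + (1 - l) * (\<bar>y\<bar> / b)) powr q"
    unfolding e[symmetric] by (rule powr_mult)
  also have "\<dots> \<le> (a + b) powr q * (l * (\<bar>x\<bar> / a) powr q + (1 - l) * (\<bar>y\<bar> / b) powr q)"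
    using assms l by (intro mult_left_mono powr_convex_comb) auto
  also have "\<dots> = (a + b) powr q * (l * (\<bar>x\<bar> powr q / a powr q) + (1 - l) * (\<bar>y\<bar> powr q / b powr q))"
    using assms by (simp add: powr_divide)
  finally show ?thesis unfolding l(3) by (simp add: l_def)
qed

lemma lq_norm_nonneg: "0 \<le> lq_norm q f"
  by (simp add: lq_norm_def)

lemma lq_fun_add:
  assumes q: "1 \<le> q" and f: "f \<in> lq_fun q" and g: "g \<in> lq_fun q"
  shows "(\<lambda>t. f t + g t) \<in> lq_fun q"
proof -
  have [measurable]: "f \<in> borel_measurable unit_leb" "g \<in> borel_measurable unit_leb"
    using f g by (auto simp: lq_fun_def)
  have "integrable unit_leb (\<lambda>t. \<bar>f t + g t\<bar> powr q)"
  proof (rule Bochner_Integration.integrable_bound)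
    show "integrable unit_leb (\<lambda>t. 2 powr q * (1/2 * \<bar>f t\<bar> powr q + 1/2 * \<bar>g t\<bar> powr q))"
      using f g by (auto simp: lq_fun_def)
    show "AE t in unit_leb. norm (\<bar>f t + g t\<bar> powr q)
        \<le> norm (2 powr q * (1/2 * \<bar>f t\<bar> powr q + 1/2 * \<bar>g t\<bar> powr q))"
    proof (rule AE_I2)
      fix t show "norm (\<bar>f t + g t\<bar> powr q)
        \<le> norm (2 powr q * (1/2 * \<bar>f t\<bar> powr q + 1/2 * \<bar>g t\<bar> powr q))"
        using abs_powr_add_le[OF q, of 1 1 "f t" "g t"] by simp
    qed
  qed measurable
  then show ?thesis by (simp add: lq_fun_def)
qed

lemma lq_fun_minus: "f \<in> lq_fun q \<Longrightarrow> (\<lambda>t. - f t) \<in> lq_fun q"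
  by (simp add: lq_fun_def)

lemma lq_fun_diff:
  "1 \<le> q \<Longrightarrow> f \<in> lq_fun q \<Longrightarrow> g \<in> lq_fun q \<Longrightarrow> (\<lambda>t. f t - g t) \<in> lq_fun q"
  using lq_fun_add[of q f "\<lambda>t. - g t"] lq_fun_minus[of g q] by simp

lemma lq_norm_cong:
  assumes "f \<in> borel_measurable unit_leb" "g \<in> borel_measurable unit_leb"
    "AE t in unit_leb. f t = g t"
  shows "lq_norm q f = lq_norm q g"
proof -
  note [measurable] = assms(1,2)
  have "(\<integral>t. \<bar>f t\<bar> powr q \<partial>unit_leb) = (\<integral>t. \<bar>g t\<bar> powr q \<partial>unit_leb)"
    using assms(3) by (intro integral_cong_AE) auto
  then show ?thesis by (simp add: lq_norm_def)
qed

lemma lq_norm_eq_0_iff: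
  assumes "f \<in> lq_fun q"
  shows "lq_norm q f = 0 \<longleftrightarrow> (AE t in unit_leb. f t = 0)"
proof -
  have "lq_norm q f = 0 \<longleftrightarrow> (\<integral>t. \<bar>f t\<bar> powr q \<partial>unit_leb) = 0"
    by (simp add: lq_norm_def)
  also have "\<dots> \<longleftrightarrow> (AE t in unit_leb. \<bar>f t\<bar> powr q = 0)"
    using assms by (intro integral_nonneg_eq_0_iff_AE) (auto simp: lq_fun_def)
  finally show ?thesis by simp
qed

lemma lq_norm_powr:
  "1 \<le> q \<Longrightarrow> lq_norm q f powr q = (\<integral>t. \<bar>f t\<bar> powr q \<partial>unit_leb)"
  by (simp add: lq_norm_def powr_powr)

lemma lq_norm_triangle:
  assumes q: "1 \<le> q" and f: "f \<in> lq_fun q" and g: "g \<in> lq_fun q"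
  shows "lq_norm q (\<lambda>t. f t + g t) \<le> lq_norm q f + lq_norm q g"
proof -
  have [measurable]: "f \<in> borel_measurable unit_leb" "g \<in> borel_measurable unit_leb"
    using f g by (auto simp: lq_fun_def)
  define a where "a = lq_norm q f"
  define b where "b = lq_norm q g"
  consider "a = 0" | "b = 0" | "a > 0" "b > 0"
    using lq_norm_nonneg[of q f] lq_norm_nonneg[of q g] unfolding a_def b_def by linarith
  then show ?thesis
  proof cases
    case 1
    then have "AE t in unit_leb. f t = 0"
      using lq_norm_eq_0_iff[OF f] by (simp add: a_def)
    then have "lq_norm q (\<lambda>t. f t + g t) = lq_norm q g"
      by (intro lq_norm_cong) auto
    then show ?thesis using lq_norm_nonneg[of q f] by simp
  next
    case 2
    then have "AE t in unit_leb. g t = 0"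
      using lq_norm_eq_0_iff[OF g] by (simp add: b_def)
    then have "lq_norm q (\<lambda>t. f t + g t) = lq_norm q f"
      by (intro lq_norm_cong) auto
    then show ?thesis using lq_norm_nonneg[of q g] by simp
  next
    case 3
    let ?h = "\<lambda>t. (a + b) powr q * (a / (a + b) * (\<bar>f t\<bar> powr q / a powr q)
                + b / (a + b) * (\<bar>g t\<bar> powr q / b powr q))"
    have fi: "integrable unit_leb (\<lambda>t. \<bar>f t\<bar> powr q)" and gi: "integrable unit_leb (\<lambda>t. \<bar>g t\<bar> powr q)"
      using f g by (auto simp: lq_fun_def)
    have "(\<integral>t. \<bar>f t + g t\<bar> powr q \<partial>unit_leb) \<le> (\<integral>t. ?h t \<partial>unit_leb)"
      using lq_fun_add[OF q f g] fi gi
      by (intro integral_mono abs_powr_add_le[OF q 3]) (auto simp: lq_fun_def)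
    also have "\<dots> = (a + b) powr q * (a / (a + b) * ((\<integral>t. \<bar>f t\<bar> powr q \<partial>unit_leb) / a powr q)
                + b / (a + b) * ((\<integral>t. \<bar>g t\<bar> powr q \<partial>unit_leb) / b powr q))"
      using fi gi by simp
    also have "\<dots> = (a + b) powr q * (a / (a + b) + b / (a + b))"
      using 3 by (simp add: lq_norm_powr[OF q, symmetric] a_def b_def)
    also have "\<dots> = (a + b) powr q"
      using 3 by (simp add: add_divide_distrib[symmetric])
    finally have "lq_norm q (\<lambda>t. f t + g t) powr q \<le> (a + b) powr q"
      by (simp add: lq_norm_powr[OF q])
    then show ?thesis
      using q 3 powr_less_mono2[of q "a + b" "lq_norm q (\<lambda>t. f t + g t)"]
      by (fastforce simp: a_def b_def)
  qed
qed

lemma equiv_lq_rel: "equiv (lq_fun q) (lq_rel q)"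
proof (rule equivI)
  show "lq_rel q \<subseteq> lq_fun q \<times> lq_fun q" by (auto simp: lq_rel_def)
  show "refl_on (lq_fun q) (lq_rel q)" by (auto simp: refl_on_def lq_rel_def)
  show "sym (lq_rel q)" by (auto simp: sym_def lq_rel_def eq_commute)
  show "trans (lq_rel q)"
    unfolding trans_def lq_rel_def by (auto elim: AE_mp)
qed

lemma Lq_space_some:
  assumes "A \<in> Lq_space q"
  shows "(SOME f. f \<in> A) \<in> lq_fun q" "A = lq_rel q `` {SOME f. f \<in> A}"
proof -
  obtain f where f: "f \<in> lq_fun q" "A = lq_rel q `` {f}"
    using assms by (auto simp: Lq_space_def elim: quotientE)
  then have "f \<in> A" using equiv_class_self[OF equiv_lq_rel] by blast
  then have "(SOME f. f \<in> A) \<in> A" by (rule someI[where P = "\<lambda>k. k \<in> A"])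
  then have r: "(f, SOME f. f \<in> A) \<in> lq_rel q" using f(2) by auto
  then show "(SOME f. f \<in> A) \<in> lq_fun q" by (auto simp: lq_rel_def)
  show "A = lq_rel q `` {SOME f. f \<in> A}"
    using f(2) equiv_class_eq[OF equiv_lq_rel r] by (rule trans)
qed

lemma Lq_dist_class:
  assumes q: "1 \<le> q" and f: "f \<in> lq_fun q" and g: "g \<in> lq_fun q"
  shows "Lq_dist q (lq_rel q `` {f}) (lq_rel q `` {g}) = lq_norm q (\<lambda>t. f t - g t)"
proof -
  have *: "(h, SOME k. k \<in> lq_rel q `` {h}) \<in> lq_rel q" if "h \<in> lq_fun q" for h
    using someI[of "\<lambda>k. k \<in> lq_rel q `` {h}" h] equiv_class_self[OF equiv_lq_rel that] by simp
  define f' g' where "f' = (SOME k. k \<in> lq_rel q `` {f})" and "g' = (SOME k. k \<in> lq_rel q `` {g})"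
  have "(f, f') \<in> lq_rel q" "(g, g') \<in> lq_rel q"
    using *[OF f] *[OF g] by (simp_all add: f'_def g'_def)
  then have m: "f' \<in> lq_fun q" "g' \<in> lq_fun q"
    and ae: "AE t in unit_leb. f t = f' t" "AE t in unit_leb. g t = g' t"
    by (auto simp: lq_rel_def)
  have "lq_norm q (\<lambda>t. f' t - g' t) = lq_norm q (\<lambda>t. f t - g t)"
  proof (rule lq_norm_cong)
    show "AE t in unit_leb. f' t - g' t = f t - g t" using ae by auto
  qed (use lq_fun_diff[OF q] f g m in \<open>auto simp: lq_fun_def\<close>)
  then show ?thesis by (simp add: Lq_dist_def f'_def g'_def)
qed

lemma Metric_space_Lq:
  assumes q: "1 \<le> q"
  shows "Metric_space (Lq_space q) (Lq_dist q)"
proof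
  fix A B C
  show "0 \<le> Lq_dist q A B" by (simp add: Lq_dist_def lq_norm_nonneg)
  show "Lq_dist q A B = Lq_dist q B A"
    by (simp add: Lq_dist_def lq_norm_def abs_minus_commute)
  assume A: "A \<in> Lq_space q" and B: "B \<in> Lq_space q"
  define f g where "f = (SOME f. f \<in> A)" and "g = (SOME f. f \<in> B)"
  have f: "f \<in> lq_fun q" "A = lq_rel q `` {f}" and g: "g \<in> lq_fun q" "B = lq_rel q `` {g}"
    using Lq_space_some[OF A] Lq_space_some[OF B] by (simp_all add: f_def g_def)
  have "Lq_dist q A B = 0 \<longleftrightarrow> (AE t in unit_leb. f t - g t = 0)"
    using lq_norm_eq_0_iff[OF lq_fun_diff[OF q f(1) g(1)]]
    by (simp add: Lq_dist_def f_def g_def)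
  also have "\<dots> \<longleftrightarrow> (f, g) \<in> lq_rel q" using f g by (simp add: lq_rel_def)
  also have "\<dots> \<longleftrightarrow> A = B"
    using eq_equiv_class_iff[OF equiv_lq_rel f(1) g(1)] f g by simp
  finally show "Lq_dist q A B = 0 \<longleftrightarrow> A = B" .
  assume C: "C \<in> Lq_space q"
  define h where "h = (SOME f. f \<in> C)"
  have h: "h \<in> lq_fun q" using Lq_space_some[OF C] by (simp add: h_def)
  show "Lq_dist q A C \<le> Lq_dist q A B + Lq_dist q B C"
    using lq_norm_triangle[OF q lq_fun_diff[OF q f(1) g(1)] lq_fun_diff[OF q g(1) h]]
    by (simp add: Lq_dist_def f_def g_def h_def)
qed

lemma mspace_Lq [simp]: "1 \<le> q \<Longrightarrow> mspace (Lq q) = Lq_space q"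
  by (simp add: Lq_def Metric_space.mspace_metric[OF Metric_space_Lq])

lemma mdist_Lq [simp]: "1 \<le> q \<Longrightarrow> mdist (Lq q) = Lq_dist q"
  by (simp add: Lq_def Metric_space.mdist_metric[OF Metric_space_Lq])

end

theory Submission
  imports Defs
begin

text \<open>
  Take a sequence \<open>x\<close> in the unit ball of \<open>X\<close> with separation \<open>s > 0\<close>, and a sequence
  \<open>y\<close> in the target space with mutual distances at most \<open>D\<close>. The map sending \<open>x n\<close> to \<open>y n\<close> has
  Hoelder constant at most \<open>D / s powr \<alpha>\<close>. An extension of it with constant \<open>c\<close> times as large sends
  the origin, which is within distance 1 of every \<open>x n\<close>, to a point within distance
  \<open>c * D / s powr \<alpha>\<close> of every \<open>y n\<close>. So if no ball of radius less than \<open>R\<close> contains all of \<open>y\<close>,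
  then \<open>c \<ge> R / D * s powr \<alpha>\<close>, and \<open>s\<close> may be taken close to the Kottman constant
  (\<open>extension_const_ge_kottman\<close>).

  In \<open>L\<^sub>q\<close> the Rademacher functions serve as \<open>y\<close>. Two of them differ by 2 on a set of measure
  one half, so their distance is \<open>2 powr (1 - 1/q)\<close>, which is \<open>2 powr (1/q')\<close>
  (\<open>lq_norm_rademacher_diff\<close>). It remains to see that no ball of radius less than 1 contains all of
  them (\<open>lq_norm_diff_rademacher_bound_ge_1\<close>). Fix a function \<open>g\<close> and a point \<open>t\<close>. If exactly half of
  the first \<open>N\<close> signs at \<open>t\<close> are positive, then the average of the \<open>q\<close>-th powers of their distances
  to \<open>g t\<close> is at least 1 by convexity; in general it falls short of 1 by at most the absolute
  value of the mean of the signs (\<open>mean_powr_dist_rademacher_ge\<close>). By orthogonality that mean is small in \<open>L\<^sub>2\<close>, hence in \<open>L\<^sub>1\<close>, and integrating over \<open>t\<close> gives the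
  claim.
\<close>

section \<open>The Rademacher functions\<close>

text \<open>
  The exponent is \<open>Suc n\<close> so that already the function with index 0 has period 1, as the
  translation argument for orthogonality requires; exponent 0 would give a function constant on
  the unit interval up to a null set.
\<close>

definition rademacher :: "nat \<Rightarrow> real \<Rightarrow> real" where
  "rademacher n t = (if even \<lfloor>2 ^ Suc n * t\<rfloor> then 1 else - 1)"

lemma rademacher_cases: "rademacher n t = 1 \<or> rademacher n t = - 1"
  by (simp add: rademacher_def)

lemma rademacher_square [simp]: "rademacher n t * rademacher n t = 1"
  by (simp add: rademacher_def)

lemma abs_rademacher [simp]: "\<bar>rademacher n t\<bar> = 1"
  by (simp add: rademacher_def)

lemma borel_measurable_rademacher [measurable]: "rademacher n \<in> borel_measurable borel"
  unfolding rademacher_def by measurable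

lemma rademacher_shift_self: "rademacher n (t + 1 / 2 ^ Suc n) = - rademacher n t"
proof -
  have "2 ^ Suc n * (t + 1 / 2 ^ Suc n) = 2 ^ Suc n * t + 1"
    by (simp add: distrib_left)
  then have "\<lfloor>2 ^ Suc n * (t + 1 / 2 ^ Suc n)\<rfloor> = \<lfloor>2 ^ Suc n * t\<rfloor> + 1"
    by (simp del: power_Suc)
  then show ?thesis by (simp add: rademacher_def del: power_Suc)
qed

lemma rademacher_shift:
  assumes "j \<le> n"
  shows "rademacher n (t + 1 / 2 ^ j) = rademacher n t"
proof -
  have "(2::real) ^ Suc n = 2 ^ (Suc n - j) * 2 ^ j"
    using assms by (simp flip: power_add)
  then have "2 ^ Suc n * (t + 1 / 2 ^ j) = 2 ^ Suc n * t + of_int (2 ^ (Suc n - j))"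
    by (simp add: distrib_left)
  then have "\<lfloor>2 ^ Suc n * (t + 1 / 2 ^ j)\<rfloor> = \<lfloor>2 ^ Suc n * t\<rfloor> + 2 ^ (Suc n - j)"
    by (simp del: power_Suc of_int_power)
  moreover have "even ((2::int) ^ (Suc n - j))"
    using assms by simp
  ultimately show ?thesis by (simp add: rademacher_def del: power_Suc)
qed

text \<open>
  Translation by \<open>h\<close> changes the sign of \<open>G\<close>, but preserves the integral of a 1-periodic function
  over a period: the piece pushed out at one end of the interval re-enters at the other.
\<close>

lemma integral_antiperiodic_eq_0:
  fixes G :: "real \<Rightarrow> real"
  assumes int: "\<And>a b. G integrable_on {a..b}"
    and period: "\<And>t. G (t + 1) = G t"
    and anti: "\<And>t. G (t + h) = - G t"
    and h: "0 \<le> h" "h \<le> 1"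
  shows "integral {0..1} G = 0"
proof -
  have shift: "integral {a + c..b + c} G = integral {a..b} (\<lambda>t. G (t + c))" for a b c
    using integral_shift_Icc_real[of a b G c] by (simp add: o_def add.commute)
  have "integral {0..1} G = integral {0..h} G + integral {h..1} G"
    using h int by (simp add: Henstock_Kurzweil_Integration.integral_combine)
  also have "integral {0..h} G = integral {1..1 + h} G"
    using shift[of 0 1 h] period by (simp add: add.commute)
  also have "integral {1..1 + h} G + integral {h..1} G = integral {h..1 + h} G"
    using h int Henstock_Kurzweil_Integration.integral_combine[of h 1 "1 + h" G] by simp
  also have "\<dots> = - integral {0..1} G"
    using shift[of 0 h 1] anti by simp
  finally show ?thesis by simp
qed

lemma borel_measurable_unit_leb:
  "f \<in> borel_measurable borel \<Longrightarrow> f \<in> borel_measurable unit_leb"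
  by (intro measurable_restrict_space1 measurable_completion) simp

lemma rademacher_measurable_unit_leb [measurable]: "rademacher n \<in> borel_measurable unit_leb"
  by (intro borel_measurable_unit_leb) measurable

lemma integrable_unit_leb_bounded:
  fixes f :: "real \<Rightarrow> real"
  assumes "f \<in> borel_measurable unit_leb" "\<And>t. \<bar>f t\<bar> \<le> C"
  shows "integrable unit_leb f"
  using assms by (intro finite_measure.integrable_const_bound[of _ _ C] finite_measure_lebesgue_on) auto

lemma measure_unit_leb [simp]: "measure unit_leb {0..1} = 1"
  by (simp add: measure_restrict_space)

lemma integrable_rademacher_mult:
  "integrable unit_leb (\<lambda>t. rademacher n t * rademacher m t)"
  by (rule integrable_unit_leb_bounded[of _ 1]) (auto simp: abs_mult)

text \<open>
  For \<open>n < m\<close>, translation by half a period of the \<open>n\<close>-th function flips that function and is a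
  full number of periods of the \<open>m\<close>-th, so the product changes sign under it.
\<close>

lemma integral_rademacher_mult:
  assumes "n \<noteq> m"
  shows "(\<integral>t. rademacher n t * rademacher m t \<partial>unit_leb) = 0"
  using assms
proof (induction n m rule: linorder_wlog)
  case (sym n m)
  then show ?case by (simp add: mult.commute)
next
  case (le n m)
  then have "n < m" by simp
  let ?G = "\<lambda>t. rademacher n t * rademacher m t"
  have "(\<integral>t. ?G t \<partial>unit_leb) = integral {0..1} ?G"
    by (intro lebesgue_integral_eq_integral integrable_rademacher_mult) simp
  also have "\<dots> = 0"
  proof (rule integral_antiperiodic_eq_0[where h = "1 / 2 ^ Suc n"])
    fix a b :: real
    have "?G \<in> borel_measurable (lebesgue_on {a..b})"
      by (intro measurable_restrict_space1 measurable_completion) simp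
    then show "?G integrable_on {a..b}"
      by (rule measurable_bounded_by_integrable_imp_integrable_real[where g = "\<lambda>_. 1"])
        (auto simp: abs_mult)
  next
    fix t :: real
    show "?G (t + 1) = ?G t"
      using rademacher_shift[of 0 _ t] by simp
    show "?G (t + 1 / 2 ^ Suc n) = - ?G t"
      using \<open>n < m\<close> by (simp add: rademacher_shift_self rademacher_shift del: power_Suc)
  qed (simp_all add: field_simps self_le_power del: power_Suc)
  finally show ?case .
qed

lemma rademacher_lq_fun: "rademacher n \<in> lq_fun q"
  unfolding lq_fun_def by (auto intro!: integrable_unit_leb_bounded[of _ 1])

lemma lq_norm_rademacher_diff:
  assumes "1 \<le> q" "n \<noteq> m"
  shows "lq_norm q (\<lambda>t. rademacher n t - rademacher m t) = 2 powr (1 - 1 / q)"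
proof -
  \<comment> \<open>The left side takes only the values 0 and \<open>2 powr q\<close>, so it is affine in the product of signs.\<close>
  have pt: "\<bar>rademacher n t - rademacher m t\<bar> powr q
      = 2 powr q / 2 * (1 - rademacher n t * rademacher m t)" for t
    using rademacher_cases[of n t] rademacher_cases[of m t] by auto
  have "(\<integral>t. \<bar>rademacher n t - rademacher m t\<bar> powr q \<partial>unit_leb) = 2 powr q / 2"
    unfolding pt using integral_rademacher_mult[OF assms(2)] integrable_rademacher_mult[of n m]
    by (simp add: integrable_unit_leb_bounded[of _ 1])
  also have "\<dots> = 2 powr (q - 1)"
    by (simp add: powr_diff)
  finally show ?thesis
    using assms(1) by (simp add: lq_norm_def powr_powr diff_divide_distrib)
qed

section \<open>No function is close to all Rademacher functions\<close>

definition rademacher_mean :: "nat \<Rightarrow> real \<Rightarrow> real" where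
  "rademacher_mean N t = (\<Sum>n<N. rademacher n t) / N"

lemma rademacher_mean_measurable [measurable]: "rademacher_mean N \<in> borel_measurable unit_leb"
  unfolding rademacher_mean_def by measurable

lemma abs_rademacher_mean_le: "\<bar>rademacher_mean N t\<bar> \<le> 1"
proof -
  have "\<bar>\<Sum>n<N. rademacher n t\<bar> \<le> (\<Sum>n<N. \<bar>rademacher n t\<bar>)"
    by (rule sum_abs)
  then show ?thesis
    by (simp add: rademacher_mean_def divide_le_eq)
qed

lemma integral_rademacher_mean_square:
  assumes "0 < N"
  shows "(\<integral>t. (rademacher_mean N t)\<^sup>2 \<partial>unit_leb) = 1 / N"
proof -
  have "(\<integral>t. (\<Sum>n<N. \<Sum>m<N. rademacher n t * rademacher m t) \<partial>unit_leb)
      = (\<Sum>n<N. \<Sum>m<N. (\<integral>t. rademacher n t * rademacher m t \<partial>unit_leb))"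
    by (simp add: Bochner_Integration.integral_sum integrable_rademacher_mult)
  also have "\<dots> = (\<Sum>n<N. \<Sum>m<N. if n = m then 1 else 0)"
    using integral_rademacher_mult by (intro sum.cong) auto
  also have "\<dots> = N" by simp
  finally have *: "(\<integral>t. (\<Sum>n<N. \<Sum>m<N. rademacher n t * rademacher m t) \<partial>unit_leb) = N" .
  have "(rademacher_mean N t)\<^sup>2 = (\<Sum>n<N. \<Sum>m<N. rademacher n t * rademacher m t) / (real N)\<^sup>2" for t
    by (simp add: rademacher_mean_def power2_eq_square sum_product)
  then show ?thesis
    using assms * by (simp add: power2_eq_square)
qed

text \<open>
  The \<open>L\<^sub>1\<close> norm is at most the \<open>L\<^sub>2\<close> norm \<open>1 / sqrt N\<close>; the arithmetic-geometric mean
  inequality with weight \<open>e\<close> takes the place of Cauchy-Schwarz.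
\<close>

lemma integral_abs_rademacher_mean_le:
  assumes "0 < e" "1 \<le> e\<^sup>2 * real N"
  shows "(\<integral>t. \<bar>rademacher_mean N t\<bar> \<partial>unit_leb) \<le> e"
proof -
  have N: "0 < N" using assms(2) by (cases "N = 0") auto
  have sq: "integrable unit_leb (\<lambda>t. (rademacher_mean N t)\<^sup>2)"
    using abs_rademacher_mean_le by (intro integrable_unit_leb_bounded[of _ 1]) (auto simp: abs_square_le_1)
  have "\<bar>a\<bar> \<le> (e + a\<^sup>2 / e) / 2" for a :: real
  proof -
    have "0 \<le> (e - \<bar>a\<bar>)\<^sup>2" by simp
    then show ?thesis using assms(1) by (simp add: field_simps power2_eq_square)
  qed
  then have "(\<integral>t. \<bar>rademacher_mean N t\<bar> \<partial>unit_leb)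
      \<le> (\<integral>t. (e + (rademacher_mean N t)\<^sup>2 / e) / 2 \<partial>unit_leb)"
    using abs_rademacher_mean_le sq
    by (intro integral_mono integrable_unit_leb_bounded[of "\<lambda>t. \<bar>rademacher_mean N t\<bar>" 1])
      (auto simp: integrable_unit_leb_bounded[of "\<lambda>_. e" "\<bar>e\<bar>"])
  also have "\<dots> = (e + 1 / N / e) / 2"
    using sq integral_rademacher_mean_square[OF N]
    by (simp add: integrable_unit_leb_bounded[of "\<lambda>_. e" "\<bar>e\<bar>"])
  also have "\<dots> \<le> e"
    using assms N by (simp add: field_simps power2_eq_square)
  finally show ?thesis .
qed

text \<open>
  With \<open>A\<close> and \<open>B\<close> the \<open>q\<close>-th powers of the distances from \<open>y\<close> to 1 and to -1, and \<open>m\<close> the mean of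
  the signs, the right-hand side is \<open>(1 + m)/2 * A + (1 - m)/2 * B\<close>. Both weights are at least
  \<open>(1 - \<bar>m\<bar>)/2\<close>, and \<open>A + B \<ge> 2\<close> by convexity.
\<close>

lemma mean_powr_dist_rademacher_ge:
  assumes q: "1 \<le> q" and N: "0 < N"
  shows "1 - \<bar>rademacher_mean N t\<bar> \<le> (\<Sum>n<N. \<bar>y - rademacher n t\<bar> powr q) / N"
proof -
  define A B m where "A = \<bar>y - 1\<bar> powr q" and "B = \<bar>y + 1\<bar> powr q" and "m = rademacher_mean N t"
  have AB: "0 \<le> A" "0 \<le> B" by (simp_all add: A_def B_def)
  have "1 \<le> ((1/2) * \<bar>y - 1\<bar> + (1 - 1/2) * \<bar>y + 1\<bar>) powr q"
    using q abs_triangle_ineq4[of "y + 1" "y - 1"] by (intro ge_one_powr_ge_zero) auto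
  also have "\<dots> \<le> (1/2) * A + (1 - 1/2) * B"
    unfolding A_def B_def using q by (intro powr_convex_comb) auto
  finally have "1 \<le> (A + B) / 2" by simp
  moreover have m: "\<bar>m\<bar> \<le> 1" using abs_rademacher_mean_le by (simp add: m_def)
  ultimately have "1 - \<bar>m\<bar> \<le> (1 - \<bar>m\<bar>) * ((A + B) / 2)"
    using mult_left_mono[of 1 "(A + B) / 2" "1 - \<bar>m\<bar>"] by simp
  also have "\<dots> \<le> (A + B) / 2 + m * ((A - B) / 2)"
  proof -
    have "\<bar>m * (A - B)\<bar> \<le> \<bar>m\<bar> * (A + B)"
      unfolding abs_mult using AB by (intro mult_left_mono) auto
    then show ?thesis by (simp add: field_simps)
  qed
  also have "\<dots> = (\<Sum>n<N. (A + B) / 2 + rademacher n t * ((A - B) / 2)) / N"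
    using N by (simp only: m_def rademacher_mean_def sum.distrib sum_distrib_right[symmetric])
      (simp add: add_divide_distrib)
  also have "(\<Sum>n<N. (A + B) / 2 + rademacher n t * ((A - B) / 2))
      = (\<Sum>n<N. \<bar>y - rademacher n t\<bar> powr q)"
  proof (rule sum.cong)
    fix n
    show "(A + B) / 2 + rademacher n t * ((A - B) / 2) = \<bar>y - rademacher n t\<bar> powr q"
      using rademacher_cases[of n t] by (auto simp: A_def B_def field_simps)
  qed simp
  finally show ?thesis by (simp add: m_def)
qed

text \<open>
  If all the norms are at most \<open>d\<close>, then so is the \<open>q\<close>-th power mean of the first \<open>N\<close> of them, and
  the pointwise bound just proved makes the lower limit of these means at least 1.
\<close>

lemma lq_norm_diff_rademacher_bound_ge_1:
  assumes q: "1 \<le> q" and g: "g \<in> lq_fun q"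
    and d: "\<And>n. lq_norm q (\<lambda>t. g t - rademacher n t) \<le> d"
  shows "1 \<le> d"
proof -
  have d0: "0 \<le> d" using lq_norm_nonneg d[of 0] by (rule order_trans)
  have int: "integrable unit_leb (\<lambda>t. \<bar>g t - rademacher n t\<bar> powr q)" for n
    using lq_fun_diff[OF q g rademacher_lq_fun] by (simp add: lq_fun_def)
  have le: "(\<integral>t. \<bar>g t - rademacher n t\<bar> powr q \<partial>unit_leb) \<le> d powr q" for n
    unfolding lq_norm_powr[OF q, symmetric] using q d lq_norm_nonneg by (intro powr_mono2) auto
  have "1 \<le> d powr q + e" if e: "0 < e" for e
  proof -
    obtain N :: nat where N: "1 / e\<^sup>2 \<le> N" using real_arch_simple by blast
    then have "0 < real N" using e by (meson less_le_trans zero_less_divide_1_iff zero_less_power)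
    then have N0: "0 < N" by simp
    have eN: "1 \<le> e\<^sup>2 * N" using N e by (simp add: field_simps)
    have mean: "integrable unit_leb (\<lambda>t. \<bar>rademacher_mean N t\<bar>)"
      using abs_rademacher_mean_le by (intro integrable_unit_leb_bounded[of _ 1]) auto
    have "1 - e \<le> 1 - (\<integral>t. \<bar>rademacher_mean N t\<bar> \<partial>unit_leb)"
      using integral_abs_rademacher_mean_le[OF e eN] by simp
    also have "\<dots> = (\<integral>t. 1 - \<bar>rademacher_mean N t\<bar> \<partial>unit_leb)"
      using mean by (simp add: integrable_unit_leb_bounded[of "\<lambda>_. 1" 1])
    also have "\<dots> \<le> (\<integral>t. (\<Sum>n<N. \<bar>g t - rademacher n t\<bar> powr q) / N \<partial>unit_leb)"
      using mean int mean_powr_dist_rademacher_ge[OF q N0]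
      by (intro integral_mono) (auto simp: integrable_unit_leb_bounded[of "\<lambda>_. 1" 1])
    also have "\<dots> = (\<Sum>n<N. (\<integral>t. \<bar>g t - rademacher n t\<bar> powr q \<partial>unit_leb)) / N"
      using int by simp
    also have "\<dots> \<le> (\<Sum>n<N. d powr q) / N"
      using le by (intro divide_right_mono sum_mono) auto
    also have "\<dots> = d powr q" using N0 by simp
    finally show ?thesis by simp
  qed
  then have "1 \<le> d powr q" by (rule field_le_epsilon)
  then show ?thesis
    using q d0 powr_less_mono2[of q d 1] by (cases "d < 1") auto
qed

section \<open>Separated sequences bound extension constants from below\<close>

lemma mdist_le_of_Lip_le:
  assumes "Lip \<alpha> X Y F \<le> ennreal K" "0 \<le> K" "x \<in> mspace X" "y \<in> mspace X" "x \<noteq> y"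
  shows "mdist Y (F x) (F y) \<le> K * mdist X x y powr \<alpha>"
proof -
  have "ennreal (mdist Y (F x) (F y) / mdist X x y powr \<alpha>) \<le> Lip \<alpha> X Y F"
    unfolding Lip_def using assms(3-5) by (intro Sup_upper) blast
  then have "mdist Y (F x) (F y) / mdist X x y powr \<alpha> \<le> K"
    using assms(1,2) by (metis ennreal_le_iff order_trans)
  moreover have "0 < mdist X x y"
    using assms(3-5) by (metis mdist_nonneg mdist_zero order_le_less)
  ultimately show ?thesis by (simp add: divide_le_eq)
qed

text \<open>
  The obstruction is the value of an extension at the origin: it must lie within \<open>c * L\<close> of every
  \<open>y n\<close>, where \<open>L\<close> bounds the Hoelder constant of the map \<open>x n \<mapsto> y n\<close>.
\<close>

lemma extension_const_admissible_ge:
  fixes Y :: "'b metric" and y :: "nat \<Rightarrow> 'b" and x :: "nat \<Rightarrow> 'a::real_normed_vector"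
  assumes \<alpha>: "0 < \<alpha>" and D: "0 \<le> D"
    and y: "\<And>n. y n \<in> mspace Y" "\<And>n m. n \<noteq> m \<Longrightarrow> mdist Y (y n) (y m) \<le> D"
    and far: "\<And>p d. p \<in> mspace Y \<Longrightarrow> (\<And>n. mdist Y p (y n) \<le> d) \<Longrightarrow> R \<le> d"
    and x: "range x \<subseteq> cball 0 1" and s: "0 < sep x"
    and c: "0 \<le> c"
    and ext: "\<And>M f. M \<subseteq> mspace (euclidean_metric :: 'a metric)
        \<Longrightarrow> holder_map \<alpha> (submetric euclidean_metric M) Y f
        \<Longrightarrow> \<exists>F \<in> mspace euclidean_metric \<rightarrow> mspace Y. (\<forall>x\<in>M. F x = f x) \<and>
           Lip \<alpha> euclidean_metric Y F \<le> ennreal c * Lip \<alpha> (submetric euclidean_metric M) Y f"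
  shows "R * sep x powr \<alpha> \<le> c * D"
proof -
  define L where "L = D / sep x powr \<alpha>"
  define f where "f = (\<lambda>z. y (inv x z))"
  let ?M = "submetric euclidean_metric (range x)"
  have L: "0 \<le> L" using D by (simp add: L_def)
  have "inj x"
    using s sep_le[of _ _ x] by (fastforce intro: injI)
  then have fx: "f (x n) = y n" for n by (simp add: f_def)
  have Lip: "Lip \<alpha> ?M Y f \<le> ennreal L"
    unfolding Lip_def
  proof (rule Sup_least, clarsimp)
    fix n m assume ne: "x n \<noteq> x m"
    then have "n \<noteq> m" by auto
    then have "mdist Y (y n) (y m) / dist (x n) (x m) powr \<alpha> \<le> D / sep x powr \<alpha>"
      using y(2) s \<alpha> D sep_le[of n m x] by (intro frac_le powr_mono2) (auto simp: dist_norm)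
    then show "ennreal (mdist Y (f (x n)) (f (x m)) / dist (x n) (x m) powr \<alpha>) \<le> ennreal L"
      by (simp add: fx L_def ennreal_leI)
  qed
  then have "holder_map \<alpha> ?M Y f"
    using y(1) by (auto simp: holder_map_def f_def intro: le_less_trans)
  then obtain F where F: "F \<in> UNIV \<rightarrow> mspace Y" "\<And>n. F (x n) = y n"
    and LFc: "Lip \<alpha> euclidean_metric Y F \<le> ennreal c * Lip \<alpha> ?M Y f"
    using ext[of "range x" f] fx by auto
  note LFc
  also have "\<dots> \<le> ennreal (c * L)"
    using mult_left_mono[OF Lip, of "ennreal c"] c L by (simp add: ennreal_mult)
  finally have LF: "Lip \<alpha> euclidean_metric Y F \<le> ennreal (c * L)" .
  have F0: "F 0 \<in> mspace Y" using F(1) by auto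
  have "R \<le> c * L"
  proof (rule far[OF F0])
    fix n
    show "mdist Y (F 0) (y n) \<le> c * L"
    \<comment> \<open>A separated sequence may contain the origin, and the Hoelder quotient ignores equal points.\<close>
    proof (cases "x n = 0")
      case True
      then have "F 0 = y n" using F(2)[of n] by simp
      moreover have "mdist Y (y n) (y n) = 0"
        using y(1)[of n] by (metis mdist_zero)
      ultimately show ?thesis using c L by simp
    next
      case False
      have "norm (x n) \<le> 1" using x by (auto simp: image_subset_iff)
      then have "norm (x n) powr \<alpha> \<le> 1"
        using \<alpha> powr_mono2[of \<alpha> "norm (x n)" 1] by simp
      then have "c * L * norm (x n) powr \<alpha> \<le> c * L"
        using c L by (intro mult_left_le) auto
      moreover have "mdist Y (F 0) (F (x n)) \<le> c * L * norm (x n) powr \<alpha>"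
        using mdist_le_of_Lip_le[OF LF, of 0 "x n"] c L False by simp
      ultimately show ?thesis by (simp add: F(2))
    qed
  qed
  then show ?thesis using s by (simp add: L_def field_simps)
qed

lemma kottman_nonneg: "0 \<le> kottman TYPE('a::real_normed_vector)"
proof -
  have "0 \<le> sep (\<lambda>_. 0 :: 'a)" by (intro sep_greatest) auto
  also have "\<dots> \<le> kottman TYPE('a)"
    unfolding kottman_def by (intro cSup_upper bdd_above_kottman) auto
  finally show ?thesis .
qed

lemma extension_const_ge_kottman:
  fixes Y :: "'b metric" and y :: "nat \<Rightarrow> 'b"
  assumes \<alpha>: "0 < \<alpha>" and D: "0 < D" and R: "0 < R"
    and y: "\<And>n. y n \<in> mspace Y" "\<And>n m. n \<noteq> m \<Longrightarrow> mdist Y (y n) (y m) \<le> D"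
    and far: "\<And>p d. p \<in> mspace Y \<Longrightarrow> (\<And>n. mdist Y p (y n) \<le> d) \<Longrightarrow> R \<le> d"
  shows "ennreal (R / D * kottman TYPE('a::real_normed_vector) powr \<alpha>)
    \<le> extension_const \<alpha> (euclidean_metric :: 'a metric) Y"
  unfolding extension_const_def
proof (rule Inf_greatest, clarify)
  fix c :: real
  assume c: "0 < c" and ext: "\<forall>M f. M \<subseteq> mspace (euclidean_metric :: 'a metric)
        \<and> holder_map \<alpha> (submetric euclidean_metric M) Y f
        \<longrightarrow> (\<exists>F \<in> mspace euclidean_metric \<rightarrow> mspace Y. (\<forall>x\<in>M. F x = f x) \<and>
           Lip \<alpha> euclidean_metric Y F \<le> ennreal c * Lip \<alpha> (submetric euclidean_metric M) Y f)"
  \<comment> \<open>\<open>b\<close> is the separation at which the bound for a single sequence becomes an equality.\<close>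
  define b where "b = (c * D / R) powr (1 / \<alpha>)"
  have b0: "0 \<le> b" by (simp add: b_def)
  have b: "b powr \<alpha> = c * D / R"
    using \<alpha> c D R by (simp add: b_def powr_powr)
  have "kottman TYPE('a) \<le> b"
    unfolding kottman_def
  proof (rule cSup_least[OF kottman_set_nonempty], clarify)
    fix x :: "nat \<Rightarrow> 'a" assume x: "range x \<subseteq> cball 0 1"
    show "sep x \<le> b"
    proof (cases "0 < sep x")
      case True
      have "R * sep x powr \<alpha> \<le> c * D"
        using ext c D by (intro extension_const_admissible_ge[OF \<alpha> _ y far x True]) auto
      then have "sep x powr \<alpha> \<le> b powr \<alpha>"
        using R by (simp add: b field_simps)
      then show ?thesis
        using \<alpha> b0 powr_less_mono2[of \<alpha> b "sep x"] by linarith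
    qed (use b0 in simp)
  qed
  then have "kottman TYPE('a) powr \<alpha> \<le> c * D / R"
    unfolding b[symmetric] using \<alpha> kottman_nonneg by (intro powr_mono2) auto
  then show "ennreal (R / D * kottman TYPE('a) powr \<alpha>) \<le> ennreal c"
    using D R by (intro ennreal_leI) (simp add: field_simps)
qed

theorem proposition4:
  fixes q q' \<alpha> :: real
  assumes "infinite_dimensional TYPE('a::banach)"
    and "1 < q" and "q \<le> 2"
    and "1 / q + 1 / q' = 1"
    and "0 < \<alpha>" and "\<alpha> \<le> 1"
  shows "ennreal (2 powr (- (1 / q')) * kottman TYPE('a) powr \<alpha>)
           \<le> extension_const \<alpha> (euclidean_metric :: 'a metric) (Lq q)"
proof -
  have q: "1 \<le> q" using assms(2) by simp
  have q': "1 / q' = 1 - 1 / q" using assms(4) by simp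
  define y where "y n = lq_rel q `` {rademacher n}" for n
  have "ennreal (1 / 2 powr (1 / q') * kottman TYPE('a) powr \<alpha>)
      \<le> extension_const \<alpha> (euclidean_metric :: 'a metric) (Lq q)"
  proof (rule extension_const_ge_kottman)
    show "y n \<in> mspace (Lq q)" for n
      using q by (simp add: y_def Lq_space_def quotientI rademacher_lq_fun)
    show "mdist (Lq q) (y n) (y m) \<le> 2 powr (1 / q')" if "n \<noteq> m" for n m
      using that q lq_norm_rademacher_diff[OF q that]
      by (simp add: y_def q' Lq_dist_class rademacher_lq_fun)
  next
    fix p d assume p: "p \<in> mspace (Lq q)" and d: "\<And>n. mdist (Lq q) p (y n) \<le> d"
    from p q have "p \<in> Lq_space q" by simp
    then obtain g where g: "g \<in> lq_fun q" "p = lq_rel q `` {g}"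
      using Lq_space_some by blast
    show "1 \<le> d"
    proof (rule lq_norm_diff_rademacher_bound_ge_1[OF q g(1)])
      show "lq_norm q (\<lambda>t. g t - rademacher n t) \<le> d" for n
        using d[of n] q g by (simp add: y_def Lq_dist_class rademacher_lq_fun)
    qed
  qed (use assms in auto)
  then show ?thesis by (simp add: powr_minus_divide)
qed

end
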